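(* Let $G$ be a torsion abelian group. Then $\mathcal{GP}(G)$ is complete if and only if $G\cong \mathbb{Z}_{p^n}$ for some prime $p$ and some integer $n\ge 0$, or $G\cong \mathbb{Z}_{p^{\infty}}$ for some prime $p$. In fact, when $\mathcal{GP}(G)$ is complete, the first case occurs exactly when $G$ is bounded and the second case occurs exactly when $G$ is unbounded.
   Context: For a group $G$, the generalized power graph $\mathcal{GP}(G)$ is the simple undirected graph whose vertices are the non-identity elements of $G$, two distinct vertices $a,b$ being adjacent if and only if $\langle a\rangle\cap\langle b\rangle\neq 1$. A graph is complete if any two distinct vertices are adjacent; the graph with no vertices (the case of the trivial group) counts as complete. $\mathbb{Z}_{m}$ is the cyclic group of order $m$, and $\mathbb{Z}_{p^\infty}$ is the quasi-cyclic (Prüfer) $p$-group. A torsion group is bounded if it has finite exponent, and unbounded otherwise. *)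

theory Defs
  imports
    Complex_Main
    "HOL-Computational_Algebra.Primes"
    "HOL-Algebra.Elementary_Groups"
    "Graph_Theory.Pair_Digraph"
begin

text \<open>Simple undirected graphs are represented, as in \<^theory>\<open>Graph_Theory.Pair_Digraph\<close>, by symmetric
  loopfree digraphs whose arcs are ordered pairs of vertices.\<close>

definition generalized_power_graph :: "('a, 'b) monoid_scheme \<Rightarrow> 'a pair_pre_digraph" where
  "generalized_power_graph G = \<lparr>
     pverts = carrier G - {\<one>\<^bsub>G\<^esub>},
     parcs = {(a, b). a \<in> carrier G - {\<one>\<^bsub>G\<^esub>} \<and> b \<in> carrier G - {\<one>\<^bsub>G\<^esub>} \<and> a \<noteq> b \<and>
                generate G {a} \<inter> generate G {b} \<noteq> {\<one>\<^bsub>G\<^esub>}} \<rparr>"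

lemma pair_bidirected_digraph_generalized_power_graph:
  "pair_bidirected_digraph (generalized_power_graph G)"
  by unfold_locales
     (auto simp: generalized_power_graph_def symmetric_def arcs_ends_def arc_to_ends_def intro!: symI)

text \<open>The constant \<open>complete_digraph\<close> of the theory \<open>Kuratowski\<close> covers finite graphs only, whereas
  here the vertex set may be infinite.\<close>

definition complete_graph :: "'v pair_pre_digraph \<Rightarrow> bool" where
  "complete_graph \<Gamma> \<longleftrightarrow> (\<forall>u \<in> pverts \<Gamma>. \<forall>v \<in> pverts \<Gamma>. u \<noteq> v \<longrightarrow> (u, v) \<in> parcs \<Gamma>)"

definition torsion_group :: "('a, 'b) monoid_scheme \<Rightarrow> bool" where
  "torsion_group G \<longleftrightarrow> group G \<and> (\<forall>x \<in> carrier G. \<exists>n::nat. n > 0 \<and> x [^]\<^bsub>G\<^esub> n = \<one>\<^bsub>G\<^esub>)"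

definition bounded_group :: "('a, 'b) monoid_scheme \<Rightarrow> bool" where
  "bounded_group G \<longleftrightarrow> group G \<and> (\<exists>n::nat. n > 0 \<and> (\<forall>x \<in> carrier G. x [^]\<^bsub>G\<^esub> n = \<one>\<^bsub>G\<^esub>))"

text \<open>The quasi-cyclic group, realised as the group of all complex roots of unity of \<open>p\<close>-power order.\<close>

definition pruefer_group :: "nat \<Rightarrow> complex monoid" where
  "pruefer_group p = \<lparr>carrier = {z. \<exists>n::nat. z ^ (p ^ n) = 1}, monoid.mult = (*), one = 1\<rparr>"

lemma comm_group_pruefer_group:
  assumes "prime p"
  shows "comm_group (pruefer_group p)"
proof -
  have p: "p > 0" using assms by (rule prime_gt_0_nat)
  have closed: "\<exists>n. (x * y) ^ (p ^ n) = 1"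
    if "x ^ (p ^ m) = 1" "y ^ (p ^ k) = 1" for x y :: complex and m k
  proof
    have "x ^ (p ^ (m + k)) = 1" using that(1) by (simp add: power_add power_mult)
    moreover have "y ^ (p ^ (m + k)) = 1" 
      using that(2) by (simp add: power_add mult.commute[of "p ^ m"] power_mult)
    ultimately show "(x * y) ^ (p ^ (m + k)) = 1" by (simp add: power_mult_distrib)
  qed
  have inv: "\<exists>y. (\<exists>n. y ^ (p ^ n) = 1) \<and> y * x = 1" if "x ^ (p ^ m) = 1" for x :: complex and m
  proof (intro exI conjI)
    show "inverse x ^ (p ^ m) = 1" using that by (simp add: power_inverse)
    have "x \<noteq> 0" using that p by (auto simp: power_0_left)
    then show "inverse x * x = 1" by simp
  qed
  show ?thesis
    by (rule comm_groupI) (use closed inv in \<open>auto simp: pruefer_group_def intro: exI[of _ 0]\<close>)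
qed

end

theory Submission
  imports Defs "HOL-Algebra.Multiplicative_Group" "HOL-Number_Theory.Cong" "HOL-Library.Real_Mod"
begin

text \<open>If the graph is complete, two elements of prime order generate the same subgroup. Hence \<open>G\<close> is a
  \<open>p\<close>-group, and by induction on \<open>k\<close> an element of order \<open>p^k\<close> generates everything killed by \<open>p^k\<close>:
  if \<open>x\<close> is killed by \<open>p^(k+1)\<close> and \<open>y\<close> has order \<open>p^(k+1)\<close>, then \<open>x^p\<close> is a power of \<open>y^p\<close>, so \<open>x\<close>
  differs from a power of \<open>y\<close> by an element of order dividing \<open>p\<close>. If \<open>G\<close> is bounded, an element of
  maximal order therefore generates \<open>G\<close>. Otherwise there is a tower \<open>g 0, g 1, \<dots>\<close> of elements of order
  \<open>p^k\<close> with \<open>g (k+1)^p = g k\<close> that exhausts \<open>G\<close>, and any two groups with such towers are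
  isomorphic. Conversely, in a group with a tower every nontrivial subgroup contains \<open>g 1\<close>, and
  completeness passes to subgroups, in particular to the finite cyclic \<open>p\<close>-groups.\<close>

section \<open>Completeness and boundedness under embeddings and isomorphisms\<close>

lemma complete_graph_generalized_power_graph_iff:
  "complete_graph (generalized_power_graph G) \<longleftrightarrow>
     (\<forall>x \<in> carrier G. \<forall>y \<in> carrier G. x \<noteq> \<one>\<^bsub>G\<^esub> \<longrightarrow> y \<noteq> \<one>\<^bsub>G\<^esub> \<longrightarrow> x \<noteq> y \<longrightarrow>
        (\<exists>z \<in> generate G {x} \<inter> generate G {y}. z \<noteq> \<one>\<^bsub>G\<^esub>))"
proof -
  have "\<one>\<^bsub>G\<^esub> \<in> generate G {x} \<inter> generate G {y}" for x y
    by (auto intro: generate.one)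
  then have "generate G {x} \<inter> generate G {y} \<noteq> {\<one>\<^bsub>G\<^esub>} \<longleftrightarrow>
      (\<exists>z \<in> generate G {x} \<inter> generate G {y}. z \<noteq> \<one>\<^bsub>G\<^esub>)" for x y
    by blast
  then show ?thesis
    by (auto simp: complete_graph_def generalized_power_graph_def)
qed

text \<open>A common nontrivial element of the image subgroups has a preimage in each of
  \<open>generate G {x}\<close> and \<open>generate G {y}\<close>, and injectivity makes the two
  preimages equal. This covers both subgroups and isomorphic copies.\<close>

lemma complete_graph_generalized_power_graph_mon:
  assumes "group G" "group H" "h \<in> mon G H"
    and "complete_graph (generalized_power_graph H)"
  shows "complete_graph (generalized_power_graph G)"
proof -
  interpret group_hom G H h
    using assms by (simp add: group_hom_def group_hom_axioms_def mon_def)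
  have inj: "inj_on h (carrier G)"
    using assms(3) by (simp add: mon_def)
  show ?thesis
    unfolding complete_graph_generalized_power_graph_iff
  proof (intro ballI impI)
    fix x y
    assume xy: "x \<in> carrier G" "y \<in> carrier G" "x \<noteq> \<one>\<^bsub>G\<^esub>" "y \<noteq> \<one>\<^bsub>G\<^esub>" "x \<noteq> y"
    have gen: "generate G {u} \<subseteq> carrier G" "generate H {h u} = h ` generate G {u}"
      if "u \<in> carrier G" for u
      using that generate_img[of "{u}"] by (auto intro!: G.generate_incl)
    have "h x \<noteq> \<one>\<^bsub>H\<^esub>" "h y \<noteq> \<one>\<^bsub>H\<^esub>" "h x \<noteq> h y"
      using xy inj_onD[OF inj] G.one_closed hom_one by metis+
    then obtain z where z: "z \<in> generate H {h x}" "z \<in> generate H {h y}" "z \<noteq> \<one>\<^bsub>H\<^esub>"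
      using assms(4) hom_closed[OF xy(1)] hom_closed[OF xy(2)]
      unfolding complete_graph_generalized_power_graph_iff by blast
    then obtain u v where "u \<in> generate G {x}" "v \<in> generate G {y}" "z = h u" "z = h v"
      using gen(2) xy(1,2) by blast
    moreover from this have "u = v"
      using inj gen(1) xy(1,2) by (metis inj_onD subsetD)
    ultimately show "\<exists>z \<in> generate G {x} \<inter> generate G {y}. z \<noteq> \<one>\<^bsub>G\<^esub>"
      using z(3) hom_one by (metis IntI)
  qed
qed

lemma bounded_group_iso:
  assumes "G \<cong> H" "group H" "bounded_group G"
  shows "bounded_group H"
proof -
  obtain h where h: "h \<in> iso G H"
    using assms(1) by (auto simp: is_iso_def)
  interpret group_hom G H h
    using assms h by (simp add: group_hom_def group_hom_axioms_def bounded_group_def iso_def)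
  obtain n :: nat where n: "n > 0" "\<And>x. x \<in> carrier G \<Longrightarrow> x [^]\<^bsub>G\<^esub> n = \<one>\<^bsub>G\<^esub>"
    using assms(3) by (auto simp: bounded_group_def)
  have "h x [^]\<^bsub>H\<^esub> n = \<one>\<^bsub>H\<^esub>" if "x \<in> carrier G" for x
    using n(2)[OF that] that by (metis hom_nat_pow hom_one)
  moreover have "carrier H = h ` carrier G"
    using h by (simp add: iso_def bij_betw_def)
  ultimately show ?thesis
    using n(1) assms(2) by (auto simp: bounded_group_def)
qed

lemma bounded_integer_mod_group:
  "n > 0 \<Longrightarrow> bounded_group (integer_mod_group n)"
  unfolding bounded_group_def by (intro conjI exI[of _ n]) auto

section \<open>Integer powers and finite cyclic groups\<close>

context group
begin

lemma int_pow_eq_iff_cong: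
  "x \<in> carrier G \<Longrightarrow> x [^] (m::int) = x [^] n \<longleftrightarrow> [m = n] (mod int (ord x))"
  by (metis cong_iff_dvd_diff cong_sym_eq int_pow_eq)

lemma generate_subset_if_mem:
  "x \<in> generate G {y} \<Longrightarrow> y \<in> carrier G \<Longrightarrow> generate G {x} \<subseteq> generate G {y}"
  by (simp add: generate_is_subgroup generate_subgroup_incl)

lemma nat_pow_in_generate:
  "x \<in> carrier G \<Longrightarrow> x [^] (n::nat) \<in> generate G {x}"
  by (auto simp: generate_pow simp flip: int_pow_int)

lemma int_pow_in_generate:
  "x \<in> carrier G \<Longrightarrow> x [^] (n::int) \<in> generate G {x}"
  by (auto simp: generate_pow)

text \<open>Serves twice: to recognise finite cyclic groups, and to embed them into the Pruefer
  group.\<close>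

lemma int_pow_mon_integer_mod_group:
  assumes "x \<in> carrier G" "ord x > 0"
  shows "(\<lambda>k. x [^] (k::int)) \<in> mon (integer_mod_group (ord x)) G"
proof -
  have "x [^] ((k + l) mod int (ord x)) = x [^] k \<otimes> x [^] l" for k l :: int
    using assms by (subst int_pow_mult[symmetric]) (auto simp: int_pow_eq_iff_cong cong_def)
  moreover have "k = l" if "x [^] k = x [^] l" "0 \<le> k" "k < int (ord x)" "0 \<le> l" "l < int (ord x)"
    for k l :: int
    using that assms by (simp add: int_pow_eq_iff_cong cong_def)
  ultimately show ?thesis
    using assms by (auto simp: mon_def hom_def inj_on_def carrier_integer_mod_group)
qed

lemma cyclic_iso_integer_mod_group:
  assumes "x \<in> carrier G" "ord x > 0" "carrier G = generate G {x}"
  shows "G \<cong> integer_mod_group (ord x)"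
proof -
  let ?f = "\<lambda>k. x [^] (k::int)"
  have "x [^] k \<in> ?f ` carrier (integer_mod_group (ord x))" for k :: int
  proof (rule image_eqI)
    show "x [^] k = x [^] (k mod int (ord x))"
      using assms by (simp add: int_pow_eq_iff_cong)
    show "k mod int (ord x) \<in> carrier (integer_mod_group (ord x))"
      using assms by (simp add: carrier_integer_mod_group)
  qed
  then have "carrier G \<subseteq> ?f ` carrier (integer_mod_group (ord x))"
    unfolding assms(3) generate_pow[OF assms(1)] by blast
  then have "?f \<in> iso (integer_mod_group (ord x)) G"
    using int_pow_mon_integer_mod_group[OF assms(1,2)] assms(1)
    by (auto simp: iso_iff_mon_epi epi_def mon_def)
  then show ?thesis
    by (metis group.iso_sym group_integer_mod_group is_isoI)
qed

end

section \<open>Groups exhausted by a tower of cyclic p-groups\<close>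

locale pruefer_tower = group G for G (structure) +
  fixes p :: nat and g :: "nat \<Rightarrow> 'a"
  assumes prime: "prime p"
    and g_closed [simp]: "g k \<in> carrier G"
    and ord_g: "ord (g k) = p ^ k"
    and g_Suc: "g (Suc k) [^] p = g k"
    and g_covers: "x \<in> carrier G \<Longrightarrow> \<exists>k. x \<in> generate G {g k}"
begin

lemma g_add: "g (k + d) [^] (p ^ d) = g k"
proof (induction d)
  case 0
  show ?case by simp
next
  case (Suc d)
  have "g (k + Suc d) [^] (p ^ Suc d) = (g (Suc (k + d)) [^] p) [^] (p ^ d)"
    by (simp add: nat_pow_pow)
  then show ?case
    by (simp only: g_Suc Suc)
qed

lemma ex_int_pow_g:
  assumes "x \<in> carrier G"
  shows "\<exists>k m. x = g k [^] (m::int)"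
  using g_covers[OF assms] by (auto simp: generate_pow)

text \<open>Together with its mirror image below, this moves powers of \<open>g k\<close> and
  \<open>g l\<close> to the common level \<open>k + l\<close>, where they can be multiplied and
  compared.\<close>

lemma int_pow_g_left: "g k [^] m = g (k + l) [^] (int p ^ l * m)"
proof -
  have "g k = g (k + l) [^] (int (p ^ l))"
    using g_add[of k l] by (simp only: int_pow_int)
  then show ?thesis
    by (simp add: int_pow_pow)
qed

lemma int_pow_g_right: "g l [^] m = g (k + l) [^] (int p ^ k * m)"
  using int_pow_g_left[of l m k] by (simp add: add.commute)

text \<open>The criterion mentions neither the group nor the tower, only \<open>p\<close>; hence
  equalities carry over between any two towers for the same prime.\<close>

lemma int_pow_g_eq_iff:
  "g k [^] m = g l [^] n \<longleftrightarrow> [int p ^ l * m = int p ^ k * n] (mod int p ^ (k + l))"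
  unfolding int_pow_g_left[of k m l] int_pow_g_right[of l n k]
  by (simp add: int_pow_eq_iff_cong ord_g)

text \<open>If \<open>x\<close> is \<open>g k [^] m\<close> and the gcd of \<open>m\<close> and
  \<open>p ^ k\<close> is \<open>p ^ i\<close>, then \<open>i < k\<close>, and by Bezout some power
  of \<open>x\<close> is \<open>g (k - i)\<close>. Further p-th powers lead down to
  \<open>g 1\<close>.\<close>

lemma g_1_in_generate:
  assumes "x \<in> carrier G" "x \<noteq> \<one>"
  shows "g 1 \<in> generate G {x}"
proof -
  obtain k m where x: "x = g k [^] (m::int)"
    using ex_int_pow_g[OF assms(1)] by blast
  have "nat (gcd m (int p ^ k)) dvd p ^ k"
    by (subst int_dvd_int_iff[symmetric]) simp
  then obtain i where i: "i \<le> k" "nat (gcd m (int p ^ k)) = p ^ i"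
    using divides_primepow_nat[OF prime] by auto
  then have gcd: "gcd m (int p ^ k) = int p ^ i"
    unfolding nat_eq_iff by simp
  \<comment> \<open>Otherwise the order of \<open>g k\<close> divides \<open>m\<close> and
    \<open>x\<close> is trivial.\<close>
  have "i \<noteq> k"
  proof
    assume "i = k"
    then have "int p ^ k dvd m"
      using gcd by (metis gcd_dvd1)
    then have "x = \<one>"
      unfolding x by (subst int_pow_eq_id) (auto simp: ord_g)
    with assms(2) show False ..
  qed
  then obtain d where k: "k = 1 + d + i"
    using i(1) by (metis Suc_leI add.commute le_Suc_ex le_neq_implies_less plus_1_eq_Suc
        add.assoc)
  obtain u where "[m * u = int p ^ i] (mod int p ^ k)"
    using cong_solve_int[of m "int p ^ k"] gcd by auto
  \<comment> \<open>The factor \<open>1\<close> puts the exponent into the shape of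
    \<open>int_pow_g_left\<close>.\<close>
  then have "x [^] u = g k [^] (int p ^ i * 1)"
    unfolding x by (simp add: int_pow_pow int_pow_eq_iff_cong ord_g)
  also have "\<dots> = g (1 + d)"
    unfolding k using int_pow_g_left[of "1 + d" 1 i] by (simp add: int_pow_1)
  finally have "g 1 = (x [^] u) [^] (p ^ d)"
    using g_add[of 1 d] by simp
  also have "\<dots> = x [^] (u * int (p ^ d))"
    using assms(1) by (metis int_pow_int int_pow_pow)
  finally show ?thesis
    using int_pow_in_generate[OF assms(1)] by metis
qed

lemma complete_graph_tower: "complete_graph (generalized_power_graph G)"
proof -
  have "g 1 \<noteq> \<one>"
    using ord_g[of 1] prime by (metis ord_id power_one_right not_prime_1)
  then show ?thesis
    unfolding complete_graph_generalized_power_graph_iff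
    using g_1_in_generate by blast
qed

lemma not_bounded_tower: "\<not> bounded_group G"
proof
  assume "bounded_group G"
  then obtain n :: nat where n: "n > 0" "\<And>x. x \<in> carrier G \<Longrightarrow> x [^] n = \<one>"
    by (auto simp: bounded_group_def)
  \<comment> \<open>The level is chosen equal to the supposed exponent \<open>n\<close>, since
    \<open>p ^ n\<close> exceeds \<open>n\<close>.\<close>
  have "p ^ n dvd n"
    using n(2)[of "g n"] by (simp add: pow_eq_id ord_g)
  moreover have "n < p ^ n"
    using prime prime_gt_1_nat by (simp add: power_gt_expt)
  ultimately show False
    using n(1) by (simp add: nat_dvd_not_less)
qed

end

text \<open>The isomorphism sends \<open>g k [^] m\<close> to \<open>h k [^] m\<close>. The two
  directions of \<open>int_pow_g_eq_iff\<close>, used in both towers, make it well defined and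
  injective.\<close>

lemma pruefer_tower_iso:
  assumes "pruefer_tower G p g" "pruefer_tower H p h"
  shows "G \<cong> H"
proof -
  interpret G: pruefer_tower G p g by fact
  interpret H: pruefer_tower H p h by fact
  have "\<exists>km. x = g (fst km) [^]\<^bsub>G\<^esub> (snd km :: int)" if "x \<in> carrier G" for x
    using G.ex_int_pow_g[OF that] by simp
  \<comment> \<open>\<open>r\<close> picks one level and exponent for each element; the fact
    \<open>f\<close> below shows that the choice does not matter.\<close>
  then obtain r where r: "\<And>x. x \<in> carrier G \<Longrightarrow> x = g (fst (r x)) [^]\<^bsub>G\<^esub> (snd (r x) :: int)"
    by metis
  define f where "f x = h (fst (r x)) [^]\<^bsub>H\<^esub> snd (r x)" for x
  have f: "f (g k [^]\<^bsub>G\<^esub> m) = h k [^]\<^bsub>H\<^esub> m" for k and m :: int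
    using r[of "g k [^]\<^bsub>G\<^esub> m"] unfolding f_def H.int_pow_g_eq_iff
    by (metis G.g_closed G.int_pow_closed G.int_pow_g_eq_iff)
  have "f \<in> hom G H"
  proof (rule homI)
    fix x y
    assume "x \<in> carrier G" "y \<in> carrier G"
    then obtain k l and m n :: int where xy: "x = g k [^]\<^bsub>G\<^esub> m" "y = g l [^]\<^bsub>G\<^esub> n"
      using G.ex_int_pow_g by metis
    have "x \<otimes>\<^bsub>G\<^esub> y = g (k + l) [^]\<^bsub>G\<^esub> (int p ^ l * m + int p ^ k * n)"
      unfolding xy G.int_pow_g_left[of k m l] G.int_pow_g_right[of l n k]
      by (simp add: G.int_pow_mult)
    moreover have "f x \<otimes>\<^bsub>H\<^esub> f y = h (k + l) [^]\<^bsub>H\<^esub> (int p ^ l * m + int p ^ k * n)"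
      unfolding xy f H.int_pow_g_left[of k m l] H.int_pow_g_right[of l n k]
      by (simp add: H.int_pow_mult)
    ultimately show "f (x \<otimes>\<^bsub>G\<^esub> y) = f x \<otimes>\<^bsub>H\<^esub> f y"
      by (simp add: f)
  qed (simp add: f_def)
  moreover have "inj_on f (carrier G)"
  proof (rule inj_onI)
    fix x y
    assume "x \<in> carrier G" "y \<in> carrier G" "f x = f y"
    then show "x = y"
      using r[of x] r[of y] unfolding f_def H.int_pow_g_eq_iff
      by (metis G.int_pow_g_eq_iff)
  qed
  moreover have "carrier H \<subseteq> f ` carrier G"
  proof
    fix y
    assume "y \<in> carrier H"
    then obtain k and m :: int where "y = h k [^]\<^bsub>H\<^esub> m"
      using H.ex_int_pow_g by blast
    then show "y \<in> f ` carrier G"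
      by (metis G.g_closed G.int_pow_closed f imageI)
  qed
  ultimately have "f \<in> iso G H"
    by (auto simp: iso_def bij_betw_def hom_def)
  then show ?thesis
    by (rule is_isoI)
qed

section \<open>The Pruefer group as a tower of roots of unity\<close>

lemma one_pruefer_group [simp]: "\<one>\<^bsub>pruefer_group p\<^esub> = 1"
  by (simp add: pruefer_group_def)

lemma nat_pow_pruefer_group [simp]: "x [^]\<^bsub>pruefer_group p\<^esub> (n::nat) = x ^ n"
  by (induction n) (auto simp: pruefer_group_def)

text \<open>By de Moivre the power has angle \<open>2 * pi * m / n\<close>, a multiple of
  \<open>2 * pi\<close> exactly when \<open>m / n\<close> is an integer. So this root of unity is
  primitive, which gives the orders in the tower.\<close>

lemma cis_root_power_eq_1_iff:
  assumes "n > 0"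
  shows "cis (2 * pi / real n) ^ m = 1 \<longleftrightarrow> n dvd m"
proof -
  have "cis (2 * pi / real n) ^ m = 1 \<longleftrightarrow> (\<exists>k::int. real m * (2 * pi / real n) = of_int k * (2 * pi))"
    by (simp add: DeMoivre cis_eq_1_iff)
  also have "\<dots> \<longleftrightarrow> (\<exists>k::int. real_of_int (int m) = real_of_int (k * int n))"
    using assms by (auto simp: field_simps)
  also have "\<dots> \<longleftrightarrow> int n dvd int m"
    unfolding of_int_eq_iff by (auto simp: dvd_def mult.commute)
  finally show ?thesis
    by simp
qed

lemma pruefer_tower_pruefer_group:
  assumes "prime p"
  shows "pruefer_tower (pruefer_group p) p (\<lambda>k. cis (2 * pi / real (p ^ k)))"
proof -
  interpret comm_group "pruefer_group p"
    by (rule comm_group_pruefer_group) fact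
  have p: "p > 0"
    using assms prime_gt_0_nat by blast
  let ?g = "\<lambda>k. cis (2 * pi / real (p ^ k))"
  have closed: "?g k \<in> carrier (pruefer_group p)" for k
    using cis_root_power_eq_1_iff[of "p ^ k" "p ^ k"] p by (auto simp: pruefer_group_def)
  show ?thesis
  proof (intro pruefer_tower.intro pruefer_tower_axioms.intro)
    show "ord (?g k) = p ^ k" for k
      using p unfolding ord_unique[OF closed] nat_pow_pruefer_group one_pruefer_group
      by (intro allI cis_root_power_eq_1_iff) simp
    show "?g (Suc k) [^]\<^bsub>pruefer_group p\<^esub> p = ?g k" for k
      using p by (simp add: DeMoivre)
    show "\<exists>k. x \<in> generate (pruefer_group p) {?g k}" if x: "x \<in> carrier (pruefer_group p)" for x
    proof -
      obtain k where "x ^ (p ^ k) = 1"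
        using x by (auto simp: pruefer_group_def)
      \<comment> \<open>The explicit list of all \<open>p ^ k\<close>-th roots of unity exhibits
        \<open>x\<close> as a power of the primitive one.\<close>
      then obtain m where "x = cis (2 * pi * real m / real (p ^ k))"
        using bij_betw_imp_surj_on[OF bij_betw_roots_unity[of "p ^ k"]] p by auto
      then have "x = ?g k [^]\<^bsub>pruefer_group p\<^esub> m"
        by (simp add: DeMoivre mult.commute)
      then show ?thesis
        using nat_pow_in_generate[OF closed] by blast
    qed
  qed (fact is_group assms closed)+
qed

section \<open>Structure of torsion abelian groups with complete graph\<close>

context comm_group
begin

text \<open>Writing \<open>w\<close> as \<open>z [^] a\<close>, the exponent \<open>a\<close> is
  prime to \<open>q\<close>, and raising \<open>w\<close> to an inverse of \<open>a\<close> modulo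
  \<open>q\<close> recovers \<open>z\<close>.\<close>

lemma mem_generate_if_prime_exponent:
  assumes "z \<in> carrier G" "z [^] q = \<one>" "prime (q::nat)" "w \<in> generate G {z}" "w \<noteq> \<one>"
  shows "z \<in> generate G {w}"
proof -
  obtain a :: int where w: "w = z [^] a"
    using assms by (auto simp: generate_pow)
  have dvd: "int (ord z) dvd int q"
    using assms by (simp add: pow_eq_id)
  have "\<not> int q dvd a"
    using assms w dvd by (metis dvd_trans int_pow_eq_id)
  then have "coprime a (int q)"
    using assms(3) by (metis coprime_commute prime_imp_coprime prime_int_nat_transfer
        prime_nat_int_transfer)
  then obtain c where "[a * c = 1] (mod int q)"
    using cong_solve_coprime_int by blast
  then have "[a * c = 1] (mod int (ord z))"
    using dvd by (rule cong_dvd_modulus)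
  then have "z [^] (a * c) = z [^] (1::int)"
    using int_pow_eq_iff_cong assms(1) by blast
  then have "z = w [^] c"
    using assms w by (simp add: int_pow_pow int_pow_1)
  then show ?thesis
    using int_pow_in_generate[of w c] assms w by simp
qed

end

lemma prime_power_if_unique_prime_factor:
  fixes n p :: nat
  assumes "n > 0" "prime p" "\<And>q. prime q \<Longrightarrow> q dvd n \<Longrightarrow> q = p"
  shows "\<exists>k. n = p ^ k"
proof -
  have "prime_factorization n = replicate_mset (size (prime_factorization n)) p"
    using assms by (metis in_prime_factors_iff set_mset_subset_singletonD subsetI singletonI)
  then have "n = p ^ size (prime_factorization n)"
    using assms(1) by (metis less_not_refl normalize_nat_def id_apply prod_mset_prime_factorization prod_mset_replicate_mset)
  then show ?thesis ..
qed

context comm_group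
begin

context
  assumes torsion: "torsion_group G"
    and complete: "complete_graph (generalized_power_graph G)"
begin

lemma ord_pos: "x \<in> carrier G \<Longrightarrow> ord x > 0"
  using torsion by (metis torsion_group_def ord_eq_0 gr0I)

text \<open>Adjacency concerns distinct vertices only; the case \<open>x = y\<close> is supplied by
  \<open>x\<close> itself.\<close>

lemma complete_common_power:
  assumes "x \<in> carrier G" "y \<in> carrier G" "x \<noteq> \<one>" "y \<noteq> \<one>"
  shows "\<exists>z \<in> generate G {x} \<inter> generate G {y}. z \<noteq> \<one>"
proof (cases "x = y")
  case True
  then show ?thesis
    using assms by (auto intro: generate.incl)
next
  case False
  then show ?thesis
    using assms complete unfolding complete_graph_generalized_power_graph_iff by simp
qed

text \<open>A nontrivial common element \<open>z\<close> generates all of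
  \<open>generate G {x}\<close> because the exponent of \<open>x\<close> is prime, so
  \<open>x\<close> follows \<open>z\<close> into \<open>generate G {y}\<close>.\<close>

lemma complete_prime_order_mem:
  assumes "x \<in> carrier G" "y \<in> carrier G" "x \<noteq> \<one>" "y \<noteq> \<one>" "x [^] q = \<one>" "prime (q::nat)"
  shows "x \<in> generate G {y}"
proof -
  obtain z where z: "z \<in> generate G {x}" "z \<in> generate G {y}" "z \<noteq> \<one>"
    using complete_common_power[OF assms(1-4)] by blast
  then have "x \<in> generate G {z}"
    using mem_generate_if_prime_exponent assms by blast
  then show ?thesis
    using generate_subset_if_mem z(2) assms(2) by blast
qed

lemma ord_dvd_if_mem_generate:
  assumes "y \<in> carrier G" "x \<in> generate G {y}"
  shows "ord x dvd ord y"
proof -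
  obtain a :: int where x: "x = y [^] a"
    using assms by (auto simp: generate_pow)
  have "x [^] int (ord y) = \<one>"
    using assms by (simp add: x int_pow_pow int_pow_eq_id)
  then show ?thesis
    using assms x by (simp add: int_pow_int pow_eq_id)
qed

text \<open>Primes \<open>p\<close> and \<open>q\<close> dividing orders of elements are themselves
  orders of elements. By \<open>complete_prime_order_mem\<close> the element of order
  \<open>q\<close> is a power of the one of order \<open>p\<close>, so \<open>q\<close> divides
  \<open>p\<close>.\<close>

lemma complete_ord_prime_power:
  "\<exists>p. prime p \<and> (\<forall>x \<in> carrier G. \<exists>k. ord x = p ^ k)"
proof (cases "carrier G = {\<one>}")
  case True
  \<comment> \<open>In the trivial group any prime will do; 2 is taken.\<close>
  then show ?thesis
    by (intro exI[of _ 2]) (auto intro: exI[of _ 0])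
next
  case False
  have ex: "\<exists>x \<in> carrier G. ord x = q" if "y \<in> carrier G" "prime q" "q dvd ord y" for y q
  proof -
    from \<open>q dvd ord y\<close> obtain d where d: "ord y = q * d"
      by (auto simp: dvd_def)
    then have "d > 0"
      using ord_pos[OF that(1)] by simp
    then have "ord (y [^] d) = q"
      using d that(1) by (simp add: ord_pow)
    then show ?thesis
      using that(1) nat_pow_closed by blast
  qed
  obtain x0 where x0: "x0 \<in> carrier G" "x0 \<noteq> \<one>"
    using False by blast
  then have "ord x0 \<noteq> 1"
    using ord_eq_1 by blast
  then obtain p where p: "prime p" "p dvd ord x0"
    using prime_factor_nat by blast
  then obtain x where x: "x \<in> carrier G" "ord x = p"
    using ex x0 by blast
  have "q = p" if y: "y \<in> carrier G" "prime q" "q dvd ord y" for y q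
  proof -
    obtain z where z: "z \<in> carrier G" "ord z = q"
      using ex y by blast
    have "z \<noteq> \<one>" "x \<noteq> \<one>"
      using z x y p by (auto simp: not_prime_1)
    then have "z \<in> generate G {x}"
      using complete_prime_order_mem[of z x q] z x y(2) pow_ord_eq_1 by blast
    then have "q dvd p"
      using ord_dvd_if_mem_generate x z by blast
    then show ?thesis
      using p y(2) primes_dvd_imp_eq by blast
  qed
  then have "\<exists>k. ord y = p ^ k" if "y \<in> carrier G" for y
    using that ord_pos[OF that] p(1) prime_power_if_unique_prime_factor by blast
  then show ?thesis
    using p(1) by blast
qed

lemma complete_mem_generate:
  assumes "prime p" "y \<in> carrier G" "ord y = p ^ k" "x \<in> carrier G" "x [^] (p ^ k) = \<one>"
  shows "x \<in> generate G {y}"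
  using assms(2-)
\<comment> \<open>Both elements vary, since the hypothesis is applied to \<open>x [^] p\<close> and
  \<open>y [^] p\<close>.\<close>
proof (induction k arbitrary: x y)
  case 0
  then show ?case by (simp add: generate.one)
next
  case (Suc k)
  have p: "p > 0"
    using assms(1) prime_gt_0_nat by blast
  have "ord (y [^] p) = p ^ k"
    using Suc.prems p by (simp add: ord_pow)
  moreover have "(x [^] p) [^] (p ^ k) = \<one>"
    using Suc.prems by (simp add: nat_pow_pow)
  ultimately have "x [^] p \<in> generate G {y [^] p}"
    using Suc by blast
  then obtain m :: int where m: "x [^] p = (y [^] p) [^] m"
    using Suc.prems by (auto simp: generate_pow)
  \<comment> \<open>By the choice of \<open>m\<close>, the elements \<open>x\<close> and
    \<open>y [^] m\<close> have the same p-th power, so their quotient is killed by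
    \<open>p\<close>.\<close>
  define z where "z = x \<otimes> inv (y [^] m)"
  have z: "z \<in> carrier G"
    using Suc.prems by (simp add: z_def)
  have x: "x = z \<otimes> y [^] m"
    using Suc.prems by (simp add: z_def m_assoc)
  have "(y [^] m) [^] p = (y [^] p) [^] m"
    using Suc.prems by (simp add: int_pow_pow mult.commute flip: int_pow_int)
  then have "z [^] p = \<one>"
    using Suc.prems m by (simp add: z_def pow_mult_distrib m_comm nat_pow_inv)
  moreover have "y \<noteq> \<one>"
    using Suc.prems assms(1) by (metis ord_id one_eq_prime_power_iff nat.distinct(1))
  \<comment> \<open>If \<open>z\<close> is trivial, \<open>generate.one\<close> applies instead of
    \<open>complete_prime_order_mem\<close>.\<close>
  ultimately have "z \<in> generate G {y}"
    using complete_prime_order_mem[of z y p] assms(1) z Suc.prems(1) generate.one by metis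
  then show ?case
    using x int_pow_in_generate[OF Suc.prems(1)] by (metis generate.eng)
qed

lemma complete_bounded_iso:
  assumes "bounded_group G"
  shows "\<exists>p n. prime p \<and> G \<cong> integer_mod_group (p ^ n)"
proof -
  obtain p where p: "prime p" "\<And>x. x \<in> carrier G \<Longrightarrow> \<exists>k. ord x = p ^ k"
    using complete_ord_prime_power by blast
  obtain N :: nat where N: "N > 0" "\<And>x. x \<in> carrier G \<Longrightarrow> x [^] N = \<one>"
    using assms by (auto simp: bounded_group_def)
  \<comment> \<open>This bound is what guarantees an element of greatest order.\<close>
  have "ord x < Suc N" if "x \<in> carrier G" for x
    using N that by (simp add: pow_eq_id dvd_imp_le less_Suc_eq_le)
  then obtain y where y: "y \<in> carrier G" "\<And>x. x \<in> carrier G \<Longrightarrow> ord x \<le> ord y"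
    using ex_has_greatest_nat[of "\<lambda>x. x \<in> carrier G" \<one> ord "Suc N"] by blast
  obtain k where k: "ord y = p ^ k"
    using p(2)[OF y(1)] by blast
  have "x \<in> generate G {y}" if x: "x \<in> carrier G" for x
  proof (rule complete_mem_generate[OF p(1) y(1) k x])
    obtain j where j: "ord x = p ^ j"
      using p(2)[OF x] by blast
    \<comment> \<open>All orders are powers of the same prime, so the greatest one is divisible by
      the others.\<close>
    then have "j \<le> k"
      using y(2)[OF x] k power_le_imp_le_exp[OF prime_gt_1_nat[OF p(1)]] by simp
    then show "x [^] (p ^ k) = \<one>"
      using x j by (simp add: pow_eq_id le_imp_power_dvd)
  qed
  then have "carrier G = generate G {y}"
    using generate_incl[of "{y}"] y(1) by auto
  then have "G \<cong> integer_mod_group (p ^ k)"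
    using cyclic_iso_integer_mod_group[OF y(1) ord_pos[OF y(1)]] k by simp
  with p(1) show ?thesis by blast
qed

lemma complete_unbounded_iso:
  assumes "\<not> bounded_group G"
  shows "\<exists>p. prime p \<and> G \<cong> pruefer_group p"
proof -
  obtain p where p: "prime p" "\<And>x. x \<in> carrier G \<Longrightarrow> \<exists>k. ord x = p ^ k"
    using complete_ord_prime_power by blast
  have p0: "p > 0"
    using p(1) prime_gt_0_nat by blast
  \<comment> \<open>As \<open>p ^ k\<close> is not an exponent of the group, some element has order
    \<open>p ^ j\<close> with \<open>j > k\<close>; its power with exponent
    \<open>p ^ (j - k)\<close> has order \<open>p ^ k\<close>.\<close>
  have ex: "\<exists>x \<in> carrier G. ord x = p ^ k" for k
  proof -
    obtain x where x: "x \<in> carrier G" "x [^] (p ^ k) \<noteq> \<one>"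
      using assms p0 is_group unfolding bounded_group_def by (metis zero_less_power)
    obtain j where j: "ord x = p ^ j"
      using p(2)[OF x(1)] by blast
    have "\<not> j \<le> k"
      using x j by (auto simp: pow_eq_id le_imp_power_dvd)
    then have "ord (x [^] (p ^ (j - k))) = p ^ k"
      using x(1) j p0 by (simp add: ord_pow le_imp_power_dvd flip: power_diff)
    then show ?thesis
      using x(1) by blast
  qed
  \<comment> \<open>Any \<open>w\<close> of order \<open>p ^ Suc k\<close> can be corrected:
    \<open>u\<close> is the \<open>m\<close>-th power of \<open>w [^] p\<close>, so
    \<open>w [^] m\<close> is a p-th root of \<open>u\<close>.\<close>
  have step: "\<exists>v. (v \<in> carrier G \<and> ord v = p ^ Suc k) \<and> v [^] p = u"
    if u: "u \<in> carrier G" "ord u = p ^ k" for u k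
  proof -
    obtain w where w: "w \<in> carrier G" "ord w = p ^ Suc k"
      using ex by blast
    have wp: "ord (w [^] p) = p ^ k"
      using w p0 by (simp add: ord_pow)
    show ?thesis
    proof (cases k)
      \<comment> \<open>Here \<open>u\<close> and \<open>w [^] p\<close> are both trivial, so
        \<open>w\<close> itself is a root.\<close>
      case 0
      then show ?thesis
        using w wp u ord_eq_1 by (metis nat_pow_closed power_0)
    next
      case (Suc j)
      have "u \<in> generate G {w [^] p}"
        using complete_mem_generate[OF p(1) _ wp u(1)] w(1) u by (metis nat_pow_closed pow_ord_eq_1)
      then obtain m :: int where "u = (w [^] p) [^] m"
        using w by (auto simp: generate_pow)
      then have m: "(w [^] m) [^] p = u"
        using w by (simp add: int_pow_pow mult.commute flip: int_pow_int)
      obtain i where i: "ord (w [^] m) = p ^ i"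
        using p(2) w(1) by (meson int_pow_closed)
      \<comment> \<open>A trivial root would make \<open>u\<close> trivial, against its order. Hence
        taking the p-th power lowers the exponent of the order by exactly one, which forces
        \<open>i = Suc k\<close>.\<close>
      have "w [^] m \<noteq> \<one>"
        using m u Suc p(1) by (metis nat_pow_one ord_id one_eq_prime_power_iff nat.distinct(1))
      then have "i \<noteq> 0"
        using i ord_eq_1 w(1) by (metis int_pow_closed power_0)
      then obtain i' where i': "i = Suc i'"
        using not0_implies_Suc by blast
      then have "ord ((w [^] m) [^] p) = p ^ i'"
        using i w(1) p0 by (subst ord_pow) auto
      then have "p ^ i' = p ^ k"
        using m u(2) by metis
      then have "i = Suc k"
        using i' power_inject_exp[OF prime_gt_1_nat[OF p(1)]] by blast
      then show ?thesis
        using i m int_pow_closed[OF w(1)] by blast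
    qed
  qed
  \<comment> \<open>Dependent choice builds the tower, starting from an element of order 1 and
    lifting by \<open>step\<close>.\<close>
  have "\<exists>g. \<forall>k. (g k \<in> carrier G \<and> ord (g k) = p ^ k) \<and> g (Suc k) [^] p = g k"
    by (rule dependent_nat_choice) (use ex[of 0] step in blast)+
  then obtain g where g: "\<And>k. g k \<in> carrier G" "\<And>k. ord (g k) = p ^ k"
      "\<And>k. g (Suc k) [^] p = g k"
    by blast
  have "pruefer_tower G p g"
  proof (intro pruefer_tower.intro pruefer_tower_axioms.intro)
    fix x
    assume x: "x \<in> carrier G"
    then obtain k where "ord x = p ^ k"
      using p(2) by blast
    then have "x \<in> generate G {g k}"
      using complete_mem_generate[OF p(1) g(1) g(2) x] pow_ord_eq_1[OF x] by simp
    then show "\<exists>k. x \<in> generate G {g k}" ..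
  qed (fact is_group p(1) g)+
  then have "G \<cong> pruefer_group p"
    using pruefer_tower_iso pruefer_tower_pruefer_group[OF p(1)] by blast
  with p(1) show ?thesis by blast
qed

end

end

section \<open>Completeness for the two families, and the classification\<close>

lemma complete_graph_pruefer_group:
  assumes "prime p"
  shows "complete_graph (generalized_power_graph (pruefer_group p))"
  using pruefer_tower.complete_graph_tower[OF pruefer_tower_pruefer_group[OF assms]] .

text \<open>Powers of a primitive \<open>p ^ n\<close>-th root of unity embed the cyclic group into
  the Pruefer group, from which completeness is inherited.\<close>

lemma complete_graph_integer_mod_group_prime_power:
  assumes "prime p"
  shows "complete_graph (generalized_power_graph (integer_mod_group (p ^ n)))"
proof -
  interpret pruefer_tower "pruefer_group p" p "\<lambda>k. cis (2 * pi / real (p ^ k))"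
    by (rule pruefer_tower_pruefer_group) fact
  have "p ^ n > 0"
    using assms prime_gt_0_nat by simp
  then have "(\<lambda>k. cis (2 * pi / real (p ^ n)) [^]\<^bsub>pruefer_group p\<^esub> (k::int))
      \<in> mon (integer_mod_group (p ^ n)) (pruefer_group p)"
    using int_pow_mon_integer_mod_group[OF g_closed, of n] unfolding ord_g by blast
  then show ?thesis
    using complete_graph_generalized_power_graph_mon[OF group_integer_mod_group is_group]
      complete_graph_tower by blast
qed

lemma complete_graph_generalized_power_graph_iso:
  assumes "group G" "group H" "G \<cong> H" "complete_graph (generalized_power_graph H)"
  shows "complete_graph (generalized_power_graph G)"
proof -
  obtain h where "h \<in> mon G H"
    using assms(3) by (auto simp: is_iso_def iso_iff_mon_epi)
  then show ?thesis
    using assms complete_graph_generalized_power_graph_mon by blast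
qed

theorem theorem2p2:
  fixes G :: "('a, 'b) monoid_scheme"
  assumes "comm_group G" and "torsion_group G"
  shows "(complete_graph (generalized_power_graph G) \<longleftrightarrow>
            (\<exists>(p::nat) (n::nat). prime p \<and> G \<cong> integer_mod_group (p ^ n)) \<or>
            (\<exists>p::nat. prime p \<and> G \<cong> pruefer_group p)) \<and>
         (complete_graph (generalized_power_graph G) \<longrightarrow>
            ((\<exists>(p::nat) (n::nat). prime p \<and> G \<cong> integer_mod_group (p ^ n)) \<longleftrightarrow> bounded_group G) \<and>
            ((\<exists>p::nat. prime p \<and> G \<cong> pruefer_group p) \<longleftrightarrow> \<not> bounded_group G))"
proof -
  interpret comm_group G by fact
  let ?complete = "complete_graph (generalized_power_graph G)"
  have pruefer: "group (pruefer_group p)" if "prime p" for p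
    using comm_group_pruefer_group[OF that] by (simp add: comm_group_def)
  \<comment> \<open>Each isomorphism type is shown to fix boundedness along with completeness, so
    that the two cases exclude each other.\<close>
  have "?complete" "bounded_group G" if "prime p" "G \<cong> integer_mod_group (p ^ n)" for p n
  proof -
    show ?complete
      using that complete_graph_integer_mod_group_prime_power group_integer_mod_group is_group
        complete_graph_generalized_power_graph_iso by blast
    have "bounded_group (integer_mod_group (p ^ n))"
      using that(1) by (intro bounded_integer_mod_group) (simp add: prime_gt_0_nat)
    then show "bounded_group G"
      using that(2) bounded_group_iso is_group iso_sym group.iso_sym group_integer_mod_group by blast
  qed
  moreover have "?complete" "\<not> bounded_group G" if "prime p" "G \<cong> pruefer_group p" for p
  proof -
    show ?complete
      using that complete_graph_pruefer_group pruefer is_group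
        complete_graph_generalized_power_graph_iso by blast
    show "\<not> bounded_group G"
      using that bounded_group_iso[OF that(2) pruefer]
        pruefer_tower.not_bounded_tower[OF pruefer_tower_pruefer_group] by blast
  qed
  ultimately show ?thesis
    using complete_bounded_iso[OF assms(2)] complete_unbounded_iso[OF assms(2)] by metis
qed

end
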